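(* Let $F:[0,T]\times X\to\mathbb{R}$ satisfy (F0)–(F3), and assume that $\nabla_x F(t,0)=0$ for all $t\in[0,T]$. Let $A(t):=\nabla_x^2F(t,0)$, let $\lambda_1(t)$ be the minimum eigenvalue of $A(t)$, and assume that $\lambda_1(0)>0$ and $\int_0^T\lambda_1(s)\,\mathrm{d}s<0$. Define $$t^*:=\min\left\{t\in(0,T):\ \int_0^t\lambda_1(s)\,\mathrm{d}s=0\right\}.$$ Let $(u_\varepsilon)_\varepsilon$ be a sequence of solutions to $\varepsilon\dot u_\varepsilon(t)=-\nabla_xF(t,u_\varepsilon(t))$ on $[0,T]$ with $u_\varepsilon(0)\to0$ as $\varepsilon\to0$. Then, for every $t\in[0,t^* )$, $u_\varepsilon(s)\to0$ as $\varepsilon\to0$ uniformly for $s\in[0,t]$.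
   Context: $T>0$ is fixed and $(X,\|\cdot\|)$ is an $n$-dimensional real Hilbert space, $n\ge1$, with scalar product $\langle\cdot,\cdot\rangle$. $\nabla_xF$ and $\nabla_x^2F$ denote the gradient and Hessian of $F(t,x)$ with respect to $x$; $\partial_tF$ is the partial derivative in $t$. The parameter $\varepsilon>0$ ranges over a sequence converging to $0$; solutions $u_\varepsilon:[0,T]\to X$ satisfy the equation for a.e. $t\in[0,T]$ (being absolutely continuous, hence $C^1$ and for all $t$). Assumptions: (F0) $F\in C^2([0,T]\times X)$. (F1) With $\mathcal{F}(u):=\sup_{t\in[0,T]}|F(t,u)|$, for every $\rho>0$ the set $\{u\in X:\mathcal{F}(u)\le\rho\}$ is bounded. (F2) There exist $C_1,C_2>0$ such that $|\partial_tF(t,u)|\le C_1F(t,u)+C_2$ for all $(t,u)\in[0,T]\times X$. (F3) For every $t\in[0,T]$ the set of critical points $C(t):=\{u\in X:\nabla_xF(t,u)=0\}$ consists of isolated points. *)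

theory Defs
  imports "HOL-Analysis.Analysis"
begin

(* Differentiability is relative to S; it is used for S = {0..T} \<times> UNIV with T > 0, where
   derivatives within S are unique (one-sided in time at the two end points). *)
definition C2_on :: "('a::real_normed_vector \<Rightarrow> 'b::real_normed_vector) \<Rightarrow> 'a set \<Rightarrow> bool"
  where "C2_on f S \<longleftrightarrow>
    (\<exists>(f' :: 'a \<Rightarrow> 'a \<Rightarrow>\<^sub>L 'b) (f'' :: 'a \<Rightarrow> 'a \<Rightarrow>\<^sub>L ('a \<Rightarrow>\<^sub>L 'b)).
       (\<forall>z\<in>S. (f has_derivative blinfun_apply (f' z)) (at z within S)) \<and>
       (\<forall>z\<in>S. (f' has_derivative blinfun_apply (f'' z)) (at z within S)) \<and>
       continuous_on S f'')"

definition gradient :: "('a::real_inner \<Rightarrow> real) \<Rightarrow> 'a \<Rightarrow> 'a"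
  where "gradient f x = (THE g. GDERIV f x :> g)"

(* The Hessian as a linear operator rather than a bilinear form. *)
definition hessian :: "('a::real_inner \<Rightarrow> real) \<Rightarrow> 'a \<Rightarrow> 'a \<Rightarrow> 'a"
  where "hessian f x = frechet_derivative (gradient f) (at x)"

definition is_eigenvalue :: "('a::real_vector \<Rightarrow> 'a) \<Rightarrow> real \<Rightarrow> bool"
  where "is_eigenvalue A l \<longleftrightarrow> (\<exists>v. v \<noteq> 0 \<and> A v = l *\<^sub>R v)"

definition min_eigenvalue :: "('a::real_vector \<Rightarrow> 'a) \<Rightarrow> real"
  where "min_eigenvalue A = (LEAST l. is_eigenvalue A l)"

definition time_derivative :: "real \<Rightarrow> (real \<Rightarrow> 'a \<Rightarrow> real) \<Rightarrow> real \<Rightarrow> 'a \<Rightarrow> real"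
  where "time_derivative T F t x = vector_derivative (\<lambda>s. F s x) (at t within {0..T})"

definition critical_points :: "(real \<Rightarrow> 'a::real_inner \<Rightarrow> real) \<Rightarrow> real \<Rightarrow> 'a set"
  where "critical_points F t = {x. gradient (F t) x = 0}"

(* The usual epsilon-delta definition; D ranges over the finite families of
   non-overlapping compact subintervals [Inf K, Sup K] of [a,b]. *)
definition absolutely_continuous_fun_on ::
    "(real \<Rightarrow> 'a::real_normed_vector) \<Rightarrow> real \<Rightarrow> real \<Rightarrow> bool"
  where "absolutely_continuous_fun_on f a b \<longleftrightarrow>
    (\<forall>e>0. \<exists>d>0. \<forall>D. D division_of \<Union>D \<and> \<Union>D \<subseteq> {a..b} \<and> (\<Sum>K\<in>D. Sup K - Inf K) < d \<longrightarrow>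
       (\<Sum>K\<in>D. norm (f (Sup K) - f (Inf K))) < e)"

definition gradient_flow_solution ::
    "real \<Rightarrow> (real \<Rightarrow> 'a::real_inner \<Rightarrow> real) \<Rightarrow> real \<Rightarrow> (real \<Rightarrow> 'a) \<Rightarrow> bool"
  where "gradient_flow_solution T F \<epsilon> u \<longleftrightarrow>
    absolutely_continuous_fun_on u 0 T \<and>
    (AE t in lebesgue_on {0..T}. \<exists>v. (u has_vector_derivative v) (at t within {0..T}) \<and>
       \<epsilon> *\<^sub>R v = - gradient (F t) (u t))"

definition lambda1 :: "(real \<Rightarrow> 'a::real_inner \<Rightarrow> real) \<Rightarrow> real \<Rightarrow> real"
  where "lambda1 F t = min_eigenvalue (hessian (F t) 0)"

definition t_star :: "real \<Rightarrow> (real \<Rightarrow> 'a::real_inner \<Rightarrow> real) \<Rightarrow> real"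
  where "t_star T F = (LEAST t. t \<in> {0<..<T} \<and> integral {0..t} (lambda1 F) = 0)"

end

(* Writing w = |u|^2, the equation gives w' = -(2/eps) <grad F(s,u), u>. As 0 is a critical point, the
   mean value theorem and the uniform continuity of the Hessian near x = 0 yield
   <grad F(s,x), x> >= (lambda1(s) - eta) |x|^2 for |x| <= delta, uniformly in s. Since lambda1(0) > 0
   and the integral of lambda1 over [0,s] is positive for 0 < s <= t < t*, eta > 0 can be chosen such
   that the integral of lambda1 - eta over [0,s] is nonnegative for all s in [0,t]. As long as
   |u| <= delta, Gronwall's inequality then gives |u(s)| <= |u(0)|; hence a solution starting inside
   the delta-ball never leaves it on [0,t], and u_eps(0) -> 0 forces uniform convergence. *)
theory Submission
  imports Defs
begin

text \<open>The equation is given only almost everywhere, while the Gronwall step needs the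
  derivative at every time. The fundamental theorem of calculus for absolutely continuous functions
  is therefore proved directly with gauges; since the right-hand side is continuous along a
  solution, the equation then holds everywhere. \<open>min_eigenvalue\<close> is a
  \<open>LEAST\<close> over a set of reals and carries information only once a minimum is known to
  exist: symmetry of the Hessian provides it through the Rayleigh quotient, which also makes
  \<open>lambda1\<close> continuous. The primitive of \<open>lambda1\<close> vanishes at time 0, so
  it has no positive lower bound on (0,t]; a bound proportional to s is what allows a constant to be
  subtracted from \<open>lambda1\<close>. The Gronwall bound presupposes that the solution stays in
  the delta-ball, which is part of the claim; a first exit time breaks this circle. The radius delta
  is chosen independently of eps, so one ball serves the whole sequence.\<close>

section \<open>Absolutely continuous functions\<close>

lemma absolutely_continuous_fun_on_subinterval:
  assumes "absolutely_continuous_fun_on f a b" "{c..d} \<subseteq> {a..b}"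
  shows "absolutely_continuous_fun_on f c d"
  using assms unfolding absolutely_continuous_fun_on_def by (meson order_trans)

text \<open>Straddle estimate for tagged intervals: as the tag \<open>x\<close> lies between the end
  points, the distances to them add up to exactly \<open>v - u\<close>, so the two one-sided errors
  combine without loss.\<close>

lemma norm_increment_le_of_derivative_bound:
  fixes f :: "real \<Rightarrow> 'a::real_normed_vector"
  assumes "x \<in> {u..v}"
    and u: "norm (f u - f x - (u - x) *\<^sub>R g) \<le> e * norm (u - x)"
    and v: "norm (f v - f x - (v - x) *\<^sub>R g) \<le> e * norm (v - x)"
  shows "norm ((v - u) *\<^sub>R g - (f v - f u)) \<le> e * (v - u)"
proof -
  have "(v - u) *\<^sub>R g - (f v - f u) = (f u - f x - (u - x) *\<^sub>R g) - (f v - f x - (v - x) *\<^sub>R g)"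
    by (simp add: algebra_simps)
  then have "norm ((v - u) *\<^sub>R g - (f v - f u)) \<le> e * norm (u - x) + e * norm (v - x)"
    using u v norm_triangle_ineq4 by (smt (verit))
  also have "\<dots> = e * (v - u)"
    using assms(1) by (simp add: algebra_simps)
  finally show ?thesis .
qed

text \<open>Outer regularity covers \<open>N\<close> by an open set of measure below the
  \<open>d\<close> of absolute continuity, and non-overlapping intervals inside it have total length
  below \<open>d\<close>. The open set is fixed before the division, so a gauge can refer to
  it.\<close>

lemma absolutely_continuous_small_on_negligible:
  fixes f :: "real \<Rightarrow> 'a::real_normed_vector"
  assumes ac: "absolutely_continuous_fun_on f a b" and N: "negligible N" and "e > 0"
  shows "\<exists>U. open U \<and> N \<subseteq> U \<and>
    (\<forall>p. p tagged_partial_division_of {a..b} \<and> \<Union>(snd ` p) \<subseteq> U \<longrightarrow>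
       (\<Sum>(x, K)\<in>p. norm (f (Sup K) - f (Inf K))) < e)"
proof -
  obtain d where "d > 0" and d: "\<And>D. \<lbrakk>D division_of \<Union>D; \<Union>D \<subseteq> {a..b}; (\<Sum>K\<in>D. Sup K - Inf K) < d\<rbrakk>
       \<Longrightarrow> (\<Sum>K\<in>D. norm (f (Sup K) - f (Inf K))) < e"
    using ac \<open>e > 0\<close> unfolding absolutely_continuous_fun_on_def by meson
  have N0: "N \<in> null_sets lebesgue"
    using N by (simp add: negligible_iff_null_sets)
  then obtain U where U: "open U" "N \<subseteq> U" "U - N \<in> lmeasurable" "emeasure lebesgue (U - N) < ennreal d"
    using sets_lebesgue_outer_open[OF _ \<open>d > 0\<close>] by blast
  have UN: "U = (U - N) \<union> N" using U by auto
  have Um: "U \<in> lmeasurable"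
    using U(3) negligible_imp_measurable[OF N] by (subst UN) (rule fmeasurable.Un)
  have "emeasure lebesgue U = emeasure lebesgue (U - N)"
    using N0 U(3) by (subst (1) UN) (rule emeasure_Un_null_set, auto)
  then have meas: "measure lebesgue U < d"
    using U(4) \<open>d > 0\<close> by (metis U(3) Um emeasure_eq_measure2 ennreal_less_iff measure_nonneg)
  show ?thesis
  proof (intro exI[of _ U] conjI allI impI; (elim conjE)?)
    fix p assume p: "p tagged_partial_division_of {a..b}" and sub: "\<Union>(snd ` p) \<subseteq> U"
    note p' = tagged_partial_division_ofD[OF p]
    have div: "snd ` p division_of \<Union>(snd ` p)"
      by (rule division_of_tagged_division[OF tagged_partial_division_of_Union_self[OF p]])
    have "(\<Sum>K\<in>snd ` p. Sup K - Inf K) = (\<Sum>K\<in>snd ` p. measure lebesgue K)"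
    proof (rule sum.cong[OF refl])
      fix K assume "K \<in> snd ` p"
      then obtain x where xK: "(x, K) \<in> p" by auto
      then obtain u v where "K = {u..v}" "x \<in> {u..v}" using p'(2,4) by (metis box_real(2))
      then show "Sup K - Inf K = measure lebesgue K" by auto
    qed
    also have "\<dots> = measure lebesgue (\<Union>(snd ` p))"
      by (rule content_division[OF div])
    also have "\<dots> \<le> measure lebesgue U"
      using sub by (intro measure_mono_fmeasurable Um fmeasurableD[OF lmeasurable_division[OF div]])
    finally have "(\<Sum>K\<in>snd ` p. Sup K - Inf K) < d" using meas by simp
    moreover have "\<Union>(snd ` p) \<subseteq> {a..b}" using p'(3) by fastforce
    ultimately have "(\<Sum>K\<in>snd ` p. norm (f (Sup K) - f (Inf K))) < e"
      using d div by blast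
    \<comment> \<open>Two tags can share an interval only if its interior is empty; such an interval
      is a single point and contributes 0, so summing over tagged pairs or over intervals is the
      same.\<close>
    moreover have "(\<Sum>K\<in>snd ` p. norm (f (Sup K) - f (Inf K))) = (\<Sum>z\<in>p. norm (f (Sup (snd z)) - f (Inf (snd z))))"
    proof (subst sum.reindex_nontrivial)
      fix y z assume yz: "y \<in> p" "z \<in> p" "y \<noteq> z" "snd y = snd z"
      obtain x K x' where y: "y = (x, K)" "z = (x', K)" using yz(4) by (metis prod.collapse)
      obtain u v where K: "K = cbox u v" "x \<in> K" using p'(2,4) yz(1) y by metis
      have "interior K = {}" using p'(5) yz y by blast
      with K have "u = v" by (auto simp: interior_cbox)
      then show "norm (f (Sup (snd y)) - f (Inf (snd y))) = 0" using y K by simp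
    qed (use p'(1) in auto)
    ultimately show "(\<Sum>(x, K)\<in>p. norm (f (Sup K) - f (Inf K))) < e"
      by (simp add: case_prod_beta)
  qed (use U in auto)
qed

text \<open>The gauge is shrunk at tags in \<open>N\<close> so that their intervals lie in an open set of small measure;
  absolute continuity bounds their contribution. The other tags are handled as in the classical theorem.\<close>

lemma fundamental_theorem_of_calculus_absolutely_continuous:
  fixes f :: "real \<Rightarrow> 'a::banach"
  assumes ab: "a \<le> b" and ac: "absolutely_continuous_fun_on f a b"
    and N: "negligible N"
    and der: "\<And>x. x \<in> {a..b} - N \<Longrightarrow> (f has_vector_derivative g x) (at x within {a..b})"
  shows "(g has_integral (f b - f a)) {a..b}"
proof -
  \<comment> \<open>\<open>g\<close> is arbitrary on \<open>N\<close>. The value 0 removes the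
    Riemann terms tagged there and leaves only increments of \<open>f\<close>, which
    \<open>small\<close> controls; a change on a null set leads back to \<open>g\<close>.\<close>
  define g0 where "g0 x = (if x \<in> N then 0 else g x)" for x
  have "(g0 has_integral (f b - f a)) {a..b}"
    unfolding has_integral_real
  proof (intro allI impI)
    fix e :: real assume "e > 0"
    \<comment> \<open>The summand 1 keeps the denominator positive when \<open>a = b\<close> and
      makes \<open>e1 * (b - a) < e / 2\<close> strict.\<close>
    define e1 where "e1 = e / (2 * (b - a + 1))"
    have e1: "e1 > 0" "e1 * (b - a) < e / 2"
      using \<open>e > 0\<close> ab by (auto simp: e1_def field_simps)
    obtain U where U: "open U" "N \<subseteq> U"
      and small: "\<And>p. \<lbrakk>p tagged_partial_division_of {a..b}; \<Union>(snd ` p) \<subseteq> U\<rbrakk>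
       \<Longrightarrow> (\<Sum>(x, K)\<in>p. norm (f (Sup K) - f (Inf K))) < e / 2"
      using absolutely_continuous_small_on_negligible[OF ac N half_gt_zero[OF \<open>e > 0\<close>]] by auto
    have "\<exists>d>0. (x \<in> {a..b} - N \<longrightarrow>
         (\<forall>y\<in>{a..b}. norm (y-x) < d \<longrightarrow> norm (f y - f x - (y-x) *\<^sub>R g x) \<le> e1 * norm (y-x)))
         \<and> (x \<in> N \<longrightarrow> ball x d \<subseteq> U)" for x
    proof (cases "x \<in> N")
      case True
      then show ?thesis using U open_contains_ball by (metis Diff_iff subsetD)
    next
      case False
      then show ?thesis
        using der[unfolded has_vector_derivative_def has_derivative_within_alt] e1(1)
        by (metis Diff_iff zero_less_one)
    qed
    then obtain d where d: "\<And>x. 0 < d x"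
      "\<And>x y. \<lbrakk>x \<in> {a..b} - N; y \<in> {a..b}; norm (y-x) < d x\<rbrakk>
                        \<Longrightarrow> norm (f y - f x - (y-x) *\<^sub>R g x) \<le> e1 * norm (y-x)"
      "\<And>x. x \<in> N \<Longrightarrow> ball x (d x) \<subseteq> U"
      by metis
    show "\<exists>\<gamma>. gauge \<gamma> \<and> (\<forall>\<D>. \<D> tagged_division_of {a..b} \<and> \<gamma> fine \<D> \<longrightarrow>
        norm ((\<Sum>(x, K)\<in>\<D>. measure lborel K *\<^sub>R g0 x) - (f b - f a)) < e)"
    proof (intro exI conjI allI impI; (elim conjE)?)
      show "gauge (\<lambda>x. ball x (d x))"
        using d(1) gauge_ball_dependent by blast
    next
      fix p assume p: "p tagged_division_of {a..b}" and fine: "(\<lambda>x. ball x (d x)) fine p"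
      note p' = tagged_division_ofD[OF p]
      define h where "h = (\<lambda>(x, K). measure lborel K *\<^sub>R g0 x - (f (Sup K) - f (Inf K)))"
      define B where "B = {z \<in> p. fst z \<in> N}"
      have ba: "b - a = (\<Sum>(x,K)\<in>p. Sup K - Inf K)" "f b - f a = (\<Sum>(x,K)\<in>p. f(Sup K) - f(Inf K))"
        using additive_tagged_division_1[where f= "\<lambda>x. x"] additive_tagged_division_1[where f= f] ab p
        by auto
      have good: "norm (h z) \<le> e1 * (case z of (x, K) \<Rightarrow> Sup K - Inf K)" if "z \<in> p - B" for z
      proof -
        obtain x K where "z = (x, K)" by (cases z)
        with that have z: "z = (x, K)" "(x, K) \<in> p" "x \<notin> N"
          by (auto simp: B_def)
        then obtain u v where K: "K = {u..v}" "x \<in> {u..v}" "{u..v} \<subseteq> {a..b}"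
          using p'(2,3,4) by (metis box_real(2))
        have ball: "K \<subseteq> ball x (d x)" using fine z by blast
        have "norm ((v - u) *\<^sub>R g x - (f v - f u)) \<le> e1 * (v - u)"
        proof (rule norm_increment_le_of_derivative_bound[OF K(2)]; rule d(2))
          have "u \<in> K" "v \<in> K" using K by auto
          then have "u \<in> ball x (d x)" "v \<in> ball x (d x)" using ball by auto
          then show "norm (u - x) < d x" "norm (v - x) < d x"
            by (auto simp: dist_real_def)
        qed (use K z in auto)
        then show ?thesis
          using z K by (auto simp: h_def g0_def)
      qed
      have bad: "norm (h z) \<le> (case z of (x, K) \<Rightarrow> norm (f (Sup K) - f (Inf K)))" if "z \<in> B" for z
        using that by (cases z) (auto simp: B_def h_def g0_def norm_minus_commute)
      have nonneg: "0 \<le> (case z of (x, K) \<Rightarrow> Sup K - Inf K)" if "z \<in> p" for z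
      proof -
        obtain x K where "z = (x, K)" by (cases z)
        with that have z: "z = (x, K)" "(x, K) \<in> p" by auto
        then obtain u v where "K = {u..v}" "x \<in> {u..v}"
          using p'(2,4) by (metis box_real(2))
        with z show ?thesis by auto
      qed
      have finB: "finite p" "B \<subseteq> p" using p'(1) by (auto simp: B_def)
      have "norm (\<Sum>z\<in>p - B. h z) \<le> (\<Sum>z\<in>p - B. e1 * (case z of (x, K) \<Rightarrow> Sup K - Inf K))"
        by (rule sum_norm_le) (use good in auto)
      also have "\<dots> \<le> (\<Sum>z\<in>p. e1 * (case z of (x, K) \<Rightarrow> Sup K - Inf K))"
        using nonneg e1 finB by (intro sum_mono2) auto
      also have "\<dots> = e1 * (b - a)"
        by (simp add: ba sum_distrib_left)
      finally have 1: "norm (\<Sum>z\<in>p - B. h z) < e / 2" using e1 by simp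
      have "norm (\<Sum>z\<in>B. h z) \<le> (\<Sum>(x, K)\<in>B. norm (f (Sup K) - f (Inf K)))"
        by (rule sum_norm_le) (use bad in auto)
      also have "\<dots> < e / 2"
      proof (rule small)
        show "B tagged_partial_division_of {a..b}"
          using p finB(2) by (meson tagged_division_of_def tagged_partial_division_subset)
        show "\<Union>(snd ` B) \<subseteq> U"
          using fine d(3) unfolding B_def by fastforce
      qed
      finally have 2: "norm (\<Sum>z\<in>B. h z) < e / 2" .
      have "(\<Sum>(x, K)\<in>p. measure lborel K *\<^sub>R g0 x) - (f b - f a) = (\<Sum>z\<in>p. h z)"
        by (simp add: ba h_def case_prod_beta sum_subtractf)
      also have "\<dots> = (\<Sum>z\<in>p - B. h z) + (\<Sum>z\<in>B. h z)"
        using finB by (simp add: sum.subset_diff)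
      finally show "norm ((\<Sum>(x, K)\<in>p. measure lborel K *\<^sub>R g0 x) - (f b - f a)) < e"
        using 1 2 norm_triangle_ineq by (smt (verit) field_sum_of_halves)
    qed
  qed
  then show ?thesis
    by (rule has_integral_spike[OF N, rotated]) (simp add: g0_def)
qed

text \<open>Up to a constant, \<open>f\<close> is the indefinite integral of \<open>g\<close>, and a
  primitive of a continuous function is differentiable at every point, including those of
  \<open>N\<close>. This turns an equation valid almost everywhere into one valid
  everywhere.\<close>

lemma absolutely_continuous_has_vector_derivative:
  fixes f :: "real \<Rightarrow> 'a::banach"
  assumes ac: "absolutely_continuous_fun_on f a b" and N: "negligible N"
    and der: "\<And>x. x \<in> {a..b} - N \<Longrightarrow> (f has_vector_derivative g x) (at x within {a..b})"
    and g: "continuous_on {a..b} g" and x: "x \<in> {a..b}"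
  shows "(f has_vector_derivative g x) (at x within {a..b})"
proof -
  have "f a + integral {a..y} g = f y" if y: "y \<in> {a..b}" for y
  proof -
    have "(g has_integral (f y - f a)) {a..y}"
    proof (rule fundamental_theorem_of_calculus_absolutely_continuous[OF _ _ N])
      show "absolutely_continuous_fun_on f a y"
        using absolutely_continuous_fun_on_subinterval[OF ac] y by auto
      show "(f has_vector_derivative g z) (at z within {a..y})" if "z \<in> {a..y} - N" for z
        by (rule has_vector_derivative_within_subset[OF der]) (use that y in auto)
    qed (use y in auto)
    then show ?thesis by (simp add: integral_unique)
  qed
  moreover have "((\<lambda>y. f a + integral {a..y} g) has_vector_derivative g x) (at x within {a..b})"
    using integral_has_vector_derivative[OF g x] by (auto intro!: derivative_eq_intros)
  ultimately show ?thesis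
    using has_vector_derivative_transform[OF x] by (metis (no_types, lifting))
qed

lemma absolutely_continuous_fun_on_imp_continuous_on:
  assumes ac: "absolutely_continuous_fun_on f a b"
  shows "continuous_on {a..b} f"
  unfolding continuous_on_iff
proof (intro ballI allI impI)
  fix x e :: real assume x: "x \<in> {a..b}" and "e > 0"
  obtain d where "d > 0" and d: "\<And>D. \<lbrakk>D division_of \<Union>D; \<Union>D \<subseteq> {a..b}; (\<Sum>K\<in>D. Sup K - Inf K) < d\<rbrakk>
       \<Longrightarrow> (\<Sum>K\<in>D. norm (f (Sup K) - f (Inf K))) < e"
    using ac \<open>e > 0\<close> unfolding absolutely_continuous_fun_on_def by meson
  have *: "dist (f v) (f u) < e" if "u \<in> {a..b}" "v \<in> {a..b}" "u \<le> v" "v - u < d" for u v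
    using d[of "{{u..v}}"] that division_of_self[of u v] by (auto simp: dist_norm)
  show "\<exists>d>0. \<forall>x'\<in>{a..b}. dist x' x < d \<longrightarrow> dist (f x') (f x) < e"
    using \<open>d > 0\<close> * x by (metis dist_commute dist_real_def abs_le_D1 abs_less_iff linear minus_diff_eq)
qed

section \<open>Second derivatives and minimal eigenvalues\<close>

text \<open>One mean value theorem in direction \<open>h\<close>, applied to the increment along
  \<open>k\<close>, and a second one in direction \<open>k\<close>. The left-hand side is symmetric
  in \<open>h\<close> and \<open>k\<close> although the right-hand side is not, which is the source
  of Schwarz's theorem.\<close>

lemma second_difference_mvt:
  fixes f :: "'a::real_normed_vector \<Rightarrow> real"
  assumes D1: "\<And>y. (f has_derivative f' y) (at y)"
    and D2: "\<And>y h. ((\<lambda>z. f' z h) has_derivative (\<lambda>k. f'' y k h)) (at y)"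
    and "s > 0"
  shows "\<exists>a\<in>{0<..<s}. \<exists>b\<in>{0<..<s}.
    f (x + s *\<^sub>R h + s *\<^sub>R k) - f (x + s *\<^sub>R h) - f (x + s *\<^sub>R k) + f x
      = s\<^sup>2 * f'' (x + a *\<^sub>R h + b *\<^sub>R k) k h"
proof -
  have lin: "f' y (c *\<^sub>R h) = c * f' y h" for y c h
    using linear_cmul[OF has_derivative_linear[OF D1]] by simp
  have lin2: "f'' y (c *\<^sub>R k) h = c * f'' y k h" for y c k h
    using linear_cmul[OF has_derivative_linear[OF D2]] by simp
  have d1: "((\<lambda>\<tau>. f (z + \<tau> *\<^sub>R h)) has_real_derivative f' (z + \<tau> *\<^sub>R h) h) (at \<tau>)" for z \<tau>
  proof -
    have "((\<lambda>\<tau>. f (z + \<tau> *\<^sub>R h)) has_derivative (\<lambda>c. f' (z + \<tau> *\<^sub>R h) (c *\<^sub>R h))) (at \<tau>)"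
      by (rule has_derivative_compose[OF _ D1]) (auto intro!: derivative_eq_intros)
    then show ?thesis by (simp add: lin has_field_derivative_def mult_commute_abs)
  qed
  have d2: "((\<lambda>\<tau>. f' (z + \<tau> *\<^sub>R k) h) has_real_derivative f'' (z + \<tau> *\<^sub>R k) k h) (at \<tau>)" for z \<tau>
  proof -
    have "((\<lambda>\<tau>. f' (z + \<tau> *\<^sub>R k) h) has_derivative (\<lambda>c. f'' (z + \<tau> *\<^sub>R k) (c *\<^sub>R k) h)) (at \<tau>)"
      by (rule has_derivative_compose[OF _ D2]) (auto intro!: derivative_eq_intros)
    then show ?thesis by (simp add: lin2 has_field_derivative_def mult_commute_abs)
  qed
  define \<psi> where "\<psi> \<tau> = f ((x + s *\<^sub>R k) + \<tau> *\<^sub>R h) - f (x + \<tau> *\<^sub>R h)" for \<tau>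
  have "\<exists>a>0. a < s \<and> \<psi> s - \<psi> 0
      = (s - 0) * (f' ((x + s *\<^sub>R k) + a *\<^sub>R h) h - f' (x + a *\<^sub>R h) h)"
    unfolding \<psi>_def by (rule MVT2) (use \<open>s > 0\<close> in \<open>auto intro!: DERIV_diff d1\<close>)
  then obtain a where a: "0 < a" "a < s"
    and \<psi>: "\<psi> s - \<psi> 0 = s * (f' ((x + s *\<^sub>R k) + a *\<^sub>R h) h - f' (x + a *\<^sub>R h) h)"
    by auto
  have "\<exists>b>0. b < s \<and> f' ((x + a *\<^sub>R h) + s *\<^sub>R k) h - f' ((x + a *\<^sub>R h) + 0 *\<^sub>R k) h
      = (s - 0) * f'' ((x + a *\<^sub>R h) + b *\<^sub>R k) k h"
    by (rule MVT2) (use \<open>s > 0\<close> in \<open>auto intro!: d2\<close>)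
  then obtain b where b: "0 < b" "b < s"
    and *: "f' ((x + s *\<^sub>R k) + a *\<^sub>R h) h - f' (x + a *\<^sub>R h) h = s * f'' (x + a *\<^sub>R h + b *\<^sub>R k) k h"
    by (auto simp: ac_simps)
  have "f (x + s *\<^sub>R h + s *\<^sub>R k) - f (x + s *\<^sub>R h) - f (x + s *\<^sub>R k) + f x = \<psi> s - \<psi> 0"
    by (simp add: \<psi>_def ac_simps)
  then show ?thesis
    using \<psi> a b unfolding *
    by (intro bexI[of _ a] bexI[of _ b]) (auto simp: power2_eq_square)
qed

text \<open>Schwarz's theorem: evaluating the same second difference in both orders gives equal
  mixed derivatives at two nearby points, and continuity at \<open>x\<close> brings both back to
  \<open>x\<close>.\<close>

lemma second_derivative_symmetric:
  fixes f :: "'a::real_normed_vector \<Rightarrow> real"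
  assumes D1: "\<And>y. (f has_derivative f' y) (at y)"
    and D2: "\<And>y h. ((\<lambda>z. f' z h) has_derivative (\<lambda>k. f'' y k h)) (at y)"
    and cont: "\<And>h k. isCont (\<lambda>y. f'' y k h) x"
  shows "f'' x h k = f'' x k h"
proof (rule ccontr)
  assume "f'' x h k \<noteq> f'' x k h"
  define e where "e = \<bar>f'' x h k - f'' x k h\<bar> / 2"
  have "e > 0" using \<open>f'' x h k \<noteq> f'' x k h\<close> by (simp add: e_def)
  obtain d1 where "d1 > 0" and d1: "\<And>y. dist y x < d1 \<Longrightarrow> \<bar>f'' y h k - f'' x h k\<bar> < e"
    using cont[of h k] \<open>e > 0\<close> unfolding continuous_at_eps_delta dist_real_def by blast
  obtain d2 where "d2 > 0" and d2: "\<And>y. dist y x < d2 \<Longrightarrow> \<bar>f'' y k h - f'' x k h\<bar> < e"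
    using cont[of k h] \<open>e > 0\<close> unfolding continuous_at_eps_delta dist_real_def by blast
  \<comment> \<open>All intermediate points lie within \<open>s * (norm h + norm k)\<close> of
    \<open>x\<close>; the summand 1 avoids division by 0 and gives a strict inequality.\<close>
  define s where "s = min d1 d2 / (norm h + norm k + 1)"
  have "s > 0" using \<open>d1 > 0\<close> \<open>d2 > 0\<close> by (auto simp: s_def intro!: divide_pos_pos add_nonneg_pos)
  have near: "dist (x + a *\<^sub>R h + b *\<^sub>R k) x < min d1 d2" if "a \<in> {0<..<s}" "b \<in> {0<..<s}" for a b
  proof -
    have "dist (x + a *\<^sub>R h + b *\<^sub>R k) x \<le> a * norm h + b * norm k"
      using that norm_triangle_ineq[of "a *\<^sub>R h" "b *\<^sub>R k"] by (simp add: dist_norm add.assoc)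
    also have "\<dots> \<le> s * norm h + s * norm k"
      using that by (intro add_mono mult_right_mono) auto
    also have "\<dots> < s * (norm h + norm k + 1)"
      using \<open>s > 0\<close> by (simp add: algebra_simps)
    also have "\<dots> = min d1 d2"
      unfolding s_def by (simp add: add_nonneg_eq_0_iff add_nonneg_pos less_imp_neq[symmetric])
    finally show ?thesis .
  qed
  obtain a b where ab: "a \<in> {0<..<s}" "b \<in> {0<..<s}"
    and 1: "f (x + s *\<^sub>R h + s *\<^sub>R k) - f (x + s *\<^sub>R h) - f (x + s *\<^sub>R k) + f x
      = s\<^sup>2 * f'' (x + a *\<^sub>R h + b *\<^sub>R k) k h"
    using second_difference_mvt[OF D1 D2 \<open>s > 0\<close>] by blast
  obtain a' b' where ab': "a' \<in> {0<..<s}" "b' \<in> {0<..<s}"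
    and 2: "f (x + s *\<^sub>R k + s *\<^sub>R h) - f (x + s *\<^sub>R k) - f (x + s *\<^sub>R h) + f x
      = s\<^sup>2 * f'' (x + a' *\<^sub>R k + b' *\<^sub>R h) h k"
    using second_difference_mvt[OF D1 D2 \<open>s > 0\<close>] by blast
  have "s\<^sup>2 * f'' (x + a *\<^sub>R h + b *\<^sub>R k) k h = s\<^sup>2 * f'' (x + a' *\<^sub>R k + b' *\<^sub>R h) h k"
    using 1 2 by (simp only: add.assoc add.commute[of "s *\<^sub>R k"])
  with \<open>s > 0\<close> have "f'' (x + a *\<^sub>R h + b *\<^sub>R k) k h = f'' (x + a' *\<^sub>R k + b' *\<^sub>R h) h k"
    by simp
  moreover have "dist (x + a' *\<^sub>R k + b' *\<^sub>R h) x < min d1 d2"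
    using near[OF ab'(2,1)] by (simp add: ac_simps)
  ultimately show False
    using d1[of "x + a' *\<^sub>R k + b' *\<^sub>R h"] d2[of "x + a *\<^sub>R h + b *\<^sub>R k"] near[OF ab]
    unfolding e_def by (auto simp: abs_if split: if_splits)
qed

text \<open>The unit sphere is compact, so the quadratic form attains a minimum \<open>m\<close> on
  it; by symmetry a minimiser is an eigenvector, and testing the form on any other eigenvector shows
  that its eigenvalue is at least \<open>m\<close>. Hence the \<open>LEAST\<close> is a true
  minimum.\<close>

lemma min_eigenvalue_rayleigh:
  fixes A :: "'a::euclidean_space \<Rightarrow> 'a"
  assumes lin: "linear A" and sym: "\<And>x y. A x \<bullet> y = x \<bullet> A y"
  obtains v where "norm v = 1" "A v = min_eigenvalue A *\<^sub>R v"
    "\<And>x. min_eigenvalue A * (x \<bullet> x) \<le> A x \<bullet> x"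
proof -
  have "continuous_on (sphere 0 1) (\<lambda>x. A x \<bullet> x)"
    using lin by (intro continuous_intros linear_continuous_on) (simp add: linear_conv_bounded_linear)
  then obtain v where v: "norm v = 1" and min: "\<And>x. norm x = 1 \<Longrightarrow> A v \<bullet> v \<le> A x \<bullet> x"
    using continuous_attains_inf[of "sphere 0 1" "\<lambda>x. A x \<bullet> x"] by auto
  define m where "m = A v \<bullet> v"
  have m: "m * (x \<bullet> x) \<le> A x \<bullet> x" for x
  proof (cases "x = 0")
    case False
    have "m \<le> A ((1 / norm x) *\<^sub>R x) \<bullet> ((1 / norm x) *\<^sub>R x)"
      unfolding m_def by (rule min) (use False in simp)
    also have "\<dots> = (A x \<bullet> x) / (x \<bullet> x)"
      by (simp add: linear_cmul[OF lin] power2_norm_eq_inner[symmetric] power2_eq_square)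
    finally show ?thesis using False by (simp add: pos_le_divide_eq)
  qed (simp add: linear_0[OF lin])
  define w where "w = A v - m *\<^sub>R v"
  have vv: "v \<bullet> v = 1" using v by (simp add: norm_eq_1)
  \<comment> \<open>The form \<open>A x \<bullet> x - m * (x \<bullet> x)\<close> is nonnegative and vanishes at \<open>v\<close>; perturb \<open>v\<close> in the direction \<open>w\<close>.\<close>
  have pert: "0 \<le> 2 * \<tau> * (w \<bullet> w) + \<tau>\<^sup>2 * (A w \<bullet> w - m * (w \<bullet> w))" for \<tau>
  proof -
    have ww: "w \<bullet> w = A v \<bullet> w - m * (v \<bullet> w)"
      unfolding w_def by (simp add: inner_diff_left)
    have "A (v + \<tau> *\<^sub>R w) \<bullet> (v + \<tau> *\<^sub>R w) - m * ((v + \<tau> *\<^sub>R w) \<bullet> (v + \<tau> *\<^sub>R w))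
        = A v \<bullet> v - m * (v \<bullet> v) + 2 * \<tau> * (A v \<bullet> w - m * (v \<bullet> w)) + \<tau>\<^sup>2 * (A w \<bullet> w - m * (w \<bullet> w))"
      using sym[of w v]
      by (simp add: linear_add[OF lin] linear_cmul[OF lin] inner_add_left inner_add_right
          power2_eq_square inner_commute algebra_simps)
    with m[of "v + \<tau> *\<^sub>R w"] ww vv show ?thesis by (simp add: m_def)
  qed
  have "w = 0"
  proof (rule ccontr)
    assume "w \<noteq> 0"
    define c where "c = A w \<bullet> w - m * (w \<bullet> w)"
    \<comment> \<open>Small enough that the quadratic term of \<open>pert\<close> at
      \<open>- \<tau>\<close> cannot compensate the negative linear term.\<close>
    define \<tau> where "\<tau> = (w \<bullet> w) / (\<bar>c\<bar> + 1)"
    have "\<tau> > 0" using \<open>w \<noteq> 0\<close> by (simp add: \<tau>_def add_nonneg_pos)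
    have "\<tau> * c \<le> \<tau> * \<bar>c\<bar>" using \<open>\<tau> > 0\<close> by simp
    also have "\<dots> < w \<bullet> w" using \<open>w \<noteq> 0\<close> by (simp add: \<tau>_def field_simps)
    finally have "\<tau> * (\<tau> * c) < \<tau> * (w \<bullet> w)" using \<open>\<tau> > 0\<close> by simp
    moreover have "2 * \<tau> * (w \<bullet> w) \<le> \<tau> * (\<tau> * c)"
      using pert[of "- \<tau>"] by (simp add: c_def power2_eq_square mult.assoc)
    moreover have "0 < \<tau> * (w \<bullet> w)" using \<open>w \<noteq> 0\<close> \<open>\<tau> > 0\<close> by simp
    ultimately show False by simp
  qed
  then have eig: "A v = m *\<^sub>R v" by (simp add: w_def)
  have "min_eigenvalue A = m"
    unfolding min_eigenvalue_def
  proof (rule Least_equality)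
    show "is_eigenvalue A m"
      unfolding is_eigenvalue_def using eig v by (intro exI[of _ v]) auto
    fix l assume "is_eigenvalue A l"
    then obtain y where "y \<noteq> 0" "A y = l *\<^sub>R y" unfolding is_eigenvalue_def by auto
    then show "m \<le> l" using m[of y] by simp
  qed
  with that v eig m show ?thesis by simp
qed

text \<open>The unit eigenvector that is optimal for \<open>B\<close> is a competitor in the
  Rayleigh quotient of \<open>A\<close>.\<close>

lemma min_eigenvalue_le:
  fixes A B :: "'a::euclidean_space \<Rightarrow> 'a"
  assumes "linear A" "\<And>x y. A x \<bullet> y = x \<bullet> A y" "linear B" "\<And>x y. B x \<bullet> y = x \<bullet> B y"
    and le: "\<And>x. norm x = 1 \<Longrightarrow> A x \<bullet> x \<le> B x \<bullet> x + c"
  shows "min_eigenvalue A \<le> min_eigenvalue B + c"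
proof -
  obtain v where v: "norm v = 1" "B v = min_eigenvalue B *\<^sub>R v"
    using min_eigenvalue_rayleigh[OF assms(3,4)] by metis
  have "min_eigenvalue A * (v \<bullet> v) \<le> A v \<bullet> v"
    using min_eigenvalue_rayleigh[OF assms(1,2)] by metis
  also have "\<dots> \<le> B v \<bullet> v + c" by (rule le[OF v(1)])
  also have "\<dots> = min_eigenvalue B * (v \<bullet> v) + c" by (simp add: v)
  finally show ?thesis using v by (simp add: norm_eq_1)
qed

text \<open>On symmetric operators the smallest eigenvalue is 1-Lipschitz in the operator norm. This
  is what makes \<open>lambda1\<close> continuous, hence integrable with a continuous
  primitive.\<close>

lemma continuous_on_min_eigenvalue:
  fixes A :: "'b::metric_space \<Rightarrow> 'a::euclidean_space \<Rightarrow>\<^sub>L 'a"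
  assumes cont: "continuous_on S A" and sym: "\<And>s x y. s \<in> S \<Longrightarrow> A s x \<bullet> y = x \<bullet> A s y"
  shows "continuous_on S (\<lambda>s. min_eigenvalue (A s))"
proof -
  have le: "min_eigenvalue (A r) \<le> min_eigenvalue (A s) + dist (A r) (A s)" if "r \<in> S" "s \<in> S" for r s
  proof (rule min_eigenvalue_le)
    fix x :: 'a assume "norm x = 1"
    have "(A r - A s) x \<bullet> x \<le> norm ((A r - A s) x) * norm x" by (rule norm_cauchy_schwarz)
    also have "\<dots> \<le> dist (A r) (A s)"
      using norm_blinfun[of "A r - A s" x] \<open>norm x = 1\<close> by (simp add: dist_norm)
    finally show "A r x \<bullet> x \<le> A s x \<bullet> x + dist (A r) (A s)"
      by (simp add: blinfun.diff_left inner_diff_left)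
  qed (use that sym in \<open>auto simp: bounded_linear.linear blinfun.bounded_linear_right\<close>)
  have "dist (min_eigenvalue (A r)) (min_eigenvalue (A s)) \<le> dist (A r) (A s)" if "r \<in> S" "s \<in> S" for r s
    using le[OF that] le[OF that(2,1)] by (simp add: dist_real_def dist_commute abs_le_iff)
  then show ?thesis
    using cont unfolding continuous_on_iff by (meson le_less_trans)
qed

section \<open>Gradient and Hessian in space, and a lower bound near a critical point\<close>

lemma gradient_eq:
  assumes "GDERIV f x :> g"
  shows "gradient f x = g"
  unfolding gradient_def
proof (rule the_equality)
  show "GDERIV f x :> g" by (fact assms)
  fix g' assume "GDERIV f x :> g'"
  then have "(\<lambda>h. h \<bullet> g') = (\<lambda>h. h \<bullet> g)"
    using assms has_derivative_unique unfolding gderiv_def by blast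
  then show "g' = g" by (metis vector_eq_ldot)
qed

text \<open>\<open>C2_on\<close> provides joint derivatives within \<open>I \<times> UNIV\<close>. A
  slice with \<open>s\<close> fixed lies entirely in this set, so composing with
  \<open>x \<mapsto> (s, x)\<close> yields unrestricted derivatives in space, even when
  \<open>s\<close> is an end point of \<open>I\<close>.\<close>

lemma C2_on_gradient_hessian:
  fixes F :: "'b::real_normed_vector \<Rightarrow> 'a::euclidean_space \<Rightarrow> real"
  assumes "C2_on (\<lambda>(s, x). F s x) (I \<times> UNIV)"
  obtains H :: "'b \<times> 'a \<Rightarrow> 'a \<Rightarrow>\<^sub>L 'a" where
    "continuous_on (I \<times> UNIV) (\<lambda>(s, x). gradient (F s) x)"
    "continuous_on (I \<times> UNIV) H"
    "\<And>s x. s \<in> I \<Longrightarrow> (gradient (F s) has_derivative H (s, x)) (at x)"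
    "\<And>s x h k. s \<in> I \<Longrightarrow> H (s, x) h \<bullet> k = h \<bullet> H (s, x) k"
proof -
  obtain f' f'' where
    f': "\<And>z. z \<in> I \<times> UNIV \<Longrightarrow> ((\<lambda>(s, x). F s x) has_derivative blinfun_apply (f' z)) (at z within I \<times> UNIV)"
    and f'': "\<And>z. z \<in> I \<times> UNIV \<Longrightarrow> (f' has_derivative blinfun_apply (f'' z)) (at z within I \<times> UNIV)"
    and cont: "continuous_on (I \<times> UNIV) f''"
    using assms unfolding C2_on_def by blast
  \<comment> \<open>\<open>P\<close> embeds the spatial directions; \<open>R\<close> is the Riesz representative of the spatial part of a functional.\<close>
  define P :: "'a \<Rightarrow>\<^sub>L ('b \<times> 'a)" where "P = Blinfun (\<lambda>h. (0, h))"
  have P: "blinfun_apply P h = (0, h)" for h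
    unfolding P_def by (subst bounded_linear_Blinfun_apply) (auto intro!: bounded_linear_intros)
  define R :: "(('b \<times> 'a) \<Rightarrow>\<^sub>L real) \<Rightarrow>\<^sub>L 'a" where "R = Blinfun (\<lambda>\<phi> :: ('b \<times> 'a) \<Rightarrow>\<^sub>L real. \<Sum>b\<in>Basis. \<phi> (0, b) *\<^sub>R b)"
  have R_def': "blinfun_apply R \<phi> = (\<Sum>b\<in>Basis. \<phi> (0, b) *\<^sub>R b)" for \<phi>
    unfolding R_def by (subst bounded_linear_Blinfun_apply) (auto intro!: bounded_linear_intros)
  have R: "R \<phi> \<bullet> h = \<phi> (0, h)" for \<phi> h
  proof -
    have "\<phi> (0, h) = (\<phi> o\<^sub>L P) (\<Sum>b\<in>Basis. (h \<bullet> b) *\<^sub>R b)"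
      by (simp add: P euclidean_representation)
    also have "\<dots> = (\<Sum>b\<in>Basis. (h \<bullet> b) * \<phi> (0, b))"
      unfolding blinfun.sum_right blinfun.scaleR_right by (simp add: P)
    also have "\<dots> = R \<phi> \<bullet> h"
      unfolding R_def' by (simp add: inner_sum_left inner_commute[of h] mult.commute)
    finally show ?thesis by simp
  qed
  have slice: "((\<lambda>x. (s, x)) has_derivative (\<lambda>h. (0, h))) (at x)" for s :: 'b and x :: 'a
    by (auto intro!: derivative_eq_intros)
  have d1: "(F s has_derivative (\<lambda>h. f' (s, x) (0, h))) (at x)" if "s \<in> I" for s x
    using has_derivative_in_compose2[where g="\<lambda>(s, x). F s x" and t="I \<times> UNIV" and s=UNIV
        and f="\<lambda>x. (s, x)", OF f' _ _ slice] that by auto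
  have d2: "((\<lambda>x. f' (s, x)) has_derivative (\<lambda>h. f'' (s, x) (0, h))) (at x)" if "s \<in> I" for s x
    using has_derivative_in_compose2[where g=f' and t="I \<times> UNIV" and s=UNIV
        and f="\<lambda>x. (s, x)", OF f'' _ _ slice] that by auto
  define H where "H z = R o\<^sub>L f'' z o\<^sub>L P" for z
  have grad: "gradient (F s) x = R (f' (s, x))" if "s \<in> I" for s x
  proof (rule gradient_eq)
    have "(\<lambda>h. h \<bullet> R (f' (s, x))) = (\<lambda>h. f' (s, x) (0, h))"
      by (simp add: R inner_commute[of _ "R (f' (s, x))"])
    then show "GDERIV (F s) x :> R (f' (s, x))"
      unfolding gderiv_def using d1[OF that] by simp
  qed
  show ?thesis
  proof
    have "continuous_on (I \<times> UNIV) f'"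
      using f'' by (rule has_derivative_continuous_on)
    then have "continuous_on (I \<times> UNIV) (\<lambda>z. R (f' z))"
      by (intro continuous_intros)
    then show "continuous_on (I \<times> UNIV) (\<lambda>(s, x). gradient (F s) x)"
      by (rule continuous_on_eq) (auto simp: grad)
    show "continuous_on (I \<times> UNIV) H"
      unfolding H_def by (intro continuous_intros cont)
    show "(gradient (F s) has_derivative H (s, x)) (at x)" if "s \<in> I" for s x
    proof -
      have "((\<lambda>x. R (f' (s, x))) has_derivative (\<lambda>h. R (f'' (s, x) (0, h)))) (at x)"
        by (rule bounded_linear.has_derivative[OF blinfun.bounded_linear_right d2[OF that]])
      moreover have "gradient (F s) = (\<lambda>x. R (f' (s, x)))" using grad[OF that] by auto
      moreover have "blinfun_apply (H (s, x)) = (\<lambda>h. R (f'' (s, x) (0, h)))"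
        by (auto simp: H_def P)
      ultimately show ?thesis by simp
    qed
    show "H (s, x) h \<bullet> k = h \<bullet> H (s, x) k" if "s \<in> I" for s x h k
    proof -
      have "f'' (s, x) (0, h) (0, k) = f'' (s, x) (0, k) (0, h)"
      proof (rule second_derivative_symmetric[where f="F s" and f'="\<lambda>y h. f' (s, y) (0, h)"
            and f''="\<lambda>y k h. f'' (s, y) (0, k) (0, h)"])
        show "((\<lambda>z. f' (s, z) (0, h)) has_derivative (\<lambda>k. f'' (s, y) (0, k) (0, h))) (at y)" for y h
          by (rule bounded_linear.has_derivative[OF blinfun.bounded_linear_left d2[OF that]])
        have "continuous_on UNIV (\<lambda>y. f'' (s, y))"
          by (rule continuous_on_compose2[OF cont]) (use that in \<open>auto intro!: continuous_intros\<close>)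
        then have "continuous_on UNIV (\<lambda>y. f'' (s, y) (0, k) (0, h))" for h k
          by (intro continuous_intros)
        then show "isCont (\<lambda>y. f'' (s, y) (0, k) (0, h)) x" for h k
          by (simp add: continuous_on_eq_continuous_at)
      qed (rule d1[OF that])
      moreover have "H (s, x) h \<bullet> k = f'' (s, x) (0, h) (0, k)" for h k
        by (simp add: H_def P R)
      ultimately show ?thesis by (simp add: inner_commute[of h])
    qed
  qed
qed

text \<open>The mean value theorem is applied to the scalar function
  \<open>\<tau> \<mapsto> G s (\<tau> *\<^sub>R x) \<bullet> x\<close>, so the Hessian enters at a
  single point of the segment from 0 to \<open>x\<close>. Compactness of \<open>I\<close> makes
  \<open>\<delta>\<close> independent of \<open>s\<close>.\<close>

lemma inner_lower_bound_near_zero: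
  fixes G :: "'b::metric_space \<Rightarrow> 'a::euclidean_space \<Rightarrow> 'a" and H :: "'b \<times> 'a \<Rightarrow> 'a \<Rightarrow>\<^sub>L 'a"
  assumes "compact I" and cont: "continuous_on (I \<times> UNIV) H"
    and der: "\<And>s x. s \<in> I \<Longrightarrow> (G s has_derivative H (s, x)) (at x)"
    and zero: "\<And>s. s \<in> I \<Longrightarrow> G s 0 = 0" and "\<eta> > 0"
  obtains \<delta> where "\<delta> > 0"
    "\<And>s x. \<lbrakk>s \<in> I; norm x \<le> \<delta>\<rbrakk> \<Longrightarrow> H (s, 0) x \<bullet> x - \<eta> * (x \<bullet> x) \<le> G s x \<bullet> x"
proof -
  have "continuous_on (I \<times> cball 0 1) H"
    by (rule continuous_on_subset[OF cont]) auto
  moreover have "compact (I \<times> cball (0::'a) 1)"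
    using \<open>compact I\<close> by (intro compact_Times) auto
  ultimately have "uniformly_continuous_on (I \<times> cball 0 1) H"
    by (rule compact_uniformly_continuous)
  then obtain d where "d > 0" and d: "\<And>z z'. \<lbrakk>z \<in> I \<times> cball 0 1; z' \<in> I \<times> cball 0 1; dist z' z < d\<rbrakk>
      \<Longrightarrow> dist (H z') (H z) < \<eta>"
    using \<open>\<eta> > 0\<close> unfolding uniformly_continuous_on_def by metis
  show ?thesis
  proof
    \<comment> \<open>The 1 keeps the segment in the compact set of uniform continuity; the half
      turns \<open>norm x \<le> \<delta>\<close> into a distance strictly below
      \<open>d\<close>.\<close>
    show "min 1 (d / 2) > 0" using \<open>d > 0\<close> by simp
    fix s and x :: 'a assume s: "s \<in> I" and x: "norm x \<le> min 1 (d / 2)"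
    have "((\<lambda>\<tau>. G s (\<tau> *\<^sub>R x) \<bullet> x) has_real_derivative H (s, \<tau> *\<^sub>R x) x \<bullet> x) (at \<tau>)" for \<tau>
    proof -
      have "((\<lambda>\<tau>. G s (\<tau> *\<^sub>R x)) has_derivative (\<lambda>c. H (s, \<tau> *\<^sub>R x) (c *\<^sub>R x))) (at \<tau>)"
        by (rule has_derivative_compose[OF _ der[OF s]]) (auto intro!: derivative_eq_intros)
      then have "((\<lambda>\<tau>. G s (\<tau> *\<^sub>R x) \<bullet> x) has_derivative (\<lambda>c. H (s, \<tau> *\<^sub>R x) (c *\<^sub>R x) \<bullet> x)) (at \<tau>)"
        by (rule has_derivative_inner_left)
      then show ?thesis
        by (simp add: has_field_derivative_def blinfun.scaleR_right mult_commute_abs)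
    qed
    then have "\<exists>\<tau>>0. \<tau> < 1 \<and> G s (1 *\<^sub>R x) \<bullet> x - G s (0 *\<^sub>R x) \<bullet> x = (1 - 0) * (H (s, \<tau> *\<^sub>R x) x \<bullet> x)"
      by (intro MVT2) auto
    then obtain \<tau> where \<tau>: "0 < \<tau>" "\<tau> < 1" and eq: "G s x \<bullet> x = H (s, \<tau> *\<^sub>R x) x \<bullet> x"
      using zero[OF s] by auto
    have "norm (\<tau> *\<^sub>R x) \<le> norm x" using \<tau> by (simp add: mult_left_le_one_le)
    then have "dist (H (s, \<tau> *\<^sub>R x)) (H (s, 0)) < \<eta>"
      using x s \<open>d > 0\<close> by (intro d) (auto simp: dist_Pair_Pair)
    then have "norm ((H (s, 0) - H (s, \<tau> *\<^sub>R x)) x) \<le> \<eta> * norm x"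
      using norm_blinfun[of "H (s, 0) - H (s, \<tau> *\<^sub>R x)" x]
      by (smt (verit) dist_norm norm_minus_commute mult_right_mono norm_ge_zero)
    then have "norm ((H (s, 0) - H (s, \<tau> *\<^sub>R x)) x) * norm x \<le> \<eta> * norm x * norm x"
      by (rule mult_right_mono) simp
    then have "(H (s, 0) - H (s, \<tau> *\<^sub>R x)) x \<bullet> x \<le> \<eta> * (x \<bullet> x)"
      using norm_cauchy_schwarz[of "(H (s, 0) - H (s, \<tau> *\<^sub>R x)) x" x]
      by (simp add: power2_norm_eq_inner[symmetric] power2_eq_square)
    then show "H (s, 0) x \<bullet> x - \<eta> * (x \<bullet> x) \<le> G s x \<bullet> x"
      by (simp add: eq blinfun.diff_left inner_diff_left)
  qed
qed

section \<open>The gradient flow near a critical point\<close>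

text \<open>Gronwall with an integrating factor: \<open>w\<close> times the exponential of the
  primitive of \<open>c\<close> has nonpositive derivative. The rate \<open>c\<close> may change
  sign, as it must when \<open>lambda1\<close> becomes negative.\<close>

lemma exponential_decay:
  fixes w w' c :: "real \<Rightarrow> real"
  assumes "a \<le> b" and c: "continuous_on {a..b} c"
    and w: "\<And>s. s \<in> {a..b} \<Longrightarrow> (w has_real_derivative w' s) (at s within {a..b})"
    and le: "\<And>s. s \<in> {a..b} \<Longrightarrow> w' s \<le> - c s * w s"
  shows "w b \<le> w a * exp (- integral {a..b} c)"
proof -
  define g where "g s = w s * exp (integral {a..s} c)" for s
  have "(g has_derivative (*) ((w' s + c s * w s) * exp (integral {a..s} c))) (at s within {a..b})"
    if s: "a \<le> s" "s \<le> b" for s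
  proof -
    have "((\<lambda>s. integral {a..s} c) has_real_derivative c s) (at s within {a..b})"
      using integral_has_real_derivative[OF c] s by auto
    then have "(g has_real_derivative w' s * exp (integral {a..s} c) + w s * (exp (integral {a..s} c) * c s)) (at s within {a..b})"
      unfolding g_def using w s by (auto intro!: derivative_eq_intros)
    then show ?thesis
      by (simp add: has_field_derivative_def algebra_simps)
  qed
  then obtain s where s: "s \<in> {a..b}"
    and "g b - g a = (w' s + c s * w s) * exp (integral {a..s} c) * (b - a)"
    using mvt_very_simple[OF \<open>a \<le> b\<close>, of g "\<lambda>s. (*) ((w' s + c s * w s) * exp (integral {a..s} c))"]
    by blast
  moreover have "(w' s + c s * w s) * exp (integral {a..s} c) * (b - a) \<le> 0"
    using le[OF s] \<open>a \<le> b\<close> by (intro mult_nonpos_nonneg) auto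
  ultimately have "w b * exp (integral {a..b} c) \<le> w a"
    by (simp add: g_def)
  then have "w b * exp (integral {a..b} c) * exp (- integral {a..b} c) \<le> w a * exp (- integral {a..b} c)"
    by (intro mult_right_mono) auto
  then show ?thesis by (simp add: exp_minus_inverse mult.assoc)
qed

text \<open>Absolute continuity makes \<open>u\<close> continuous, so the velocity prescribed by the
  equation is a continuous function of time; the times where the equation fails form a null set, and
  these are then recovered.\<close>

lemma gradient_flow_solution_has_vector_derivative:
  fixes F :: "real \<Rightarrow> 'a::euclidean_space \<Rightarrow> real"
  assumes sol: "gradient_flow_solution T F e u" and "e > 0"
    and cont: "continuous_on ({0..T} \<times> UNIV) (\<lambda>(s, x). gradient (F s) x)"
    and s: "s \<in> {0..T}"
  shows "(u has_vector_derivative - (1 / e) *\<^sub>R gradient (F s) (u s)) (at s within {0..T})"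
proof -
  define g where "g s = - (1 / e) *\<^sub>R gradient (F s) (u s)" for s
  have ac: "absolutely_continuous_fun_on u 0 T"
    using sol by (simp add: gradient_flow_solution_def)
  define Q where "Q s \<longleftrightarrow> (u has_vector_derivative g s) (at s within {0..T})" for s
  have "AE s in lebesgue_on {0..T}. Q s"
  proof -
    have "AE s in lebesgue_on {0..T}. \<exists>v. (u has_vector_derivative v) (at s within {0..T}) \<and>
       e *\<^sub>R v = - gradient (F s) (u s)"
      using sol by (simp add: gradient_flow_solution_def)
    then show ?thesis
    proof (rule AE_mp, intro AE_I2 impI)
      fix s assume "\<exists>v. (u has_vector_derivative v) (at s within {0..T}) \<and> e *\<^sub>R v = - gradient (F s) (u s)"
      then obtain v where v: "(u has_vector_derivative v) (at s within {0..T})" "e *\<^sub>R v = - gradient (F s) (u s)"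
        by blast
      have "v = (1 / e) *\<^sub>R (e *\<^sub>R v)" using \<open>e > 0\<close> by simp
      then have "v = g s" unfolding v(2) by (simp add: g_def)
      with v show "Q s" by (simp add: Q_def)
    qed
  qed
  then have "AE s in lebesgue. s \<in> {0..T} \<longrightarrow> Q s"
    by (subst (asm) AE_restrict_space_iff) auto
  then have N: "negligible {s. \<not> (s \<in> {0..T} \<longrightarrow> Q s)}"
    by (simp add: completion.AE_iff_null_sets negligible_iff_null_sets)
  have "continuous_on {0..T} (\<lambda>s. (\<lambda>(s, x). gradient (F s) x) (s, u s))"
    by (rule continuous_on_compose2[OF cont])
      (auto intro!: continuous_intros absolutely_continuous_fun_on_imp_continuous_on[OF ac])
  then have "continuous_on {0..T} g"
    unfolding g_def by (intro continuous_intros) simp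
  with absolutely_continuous_has_vector_derivative[OF ac N _ _ s, of g]
  have "(u has_vector_derivative g s) (at s within {0..T})"
    by (auto simp: Q_def)
  then show ?thesis by (simp add: g_def)
qed

section \<open>The primitive of a continuous function up to its first positive zero\<close>

lemma integral_initial_lower_bound:
  fixes l :: "real \<Rightarrow> real"
  assumes "t \<ge> 0" and l: "continuous_on {0..t} l" and "l 0 > 0"
  obtains d where "d > 0" "\<And>s. \<lbrakk>s \<in> {0..t}; s < d\<rbrakk> \<Longrightarrow> l 0 / 2 * s \<le> integral {0..s} l"
proof -
  obtain d where "d > 0" and d: "\<And>s. \<lbrakk>s \<in> {0..t}; dist s 0 < d\<rbrakk> \<Longrightarrow> dist (l s) (l 0) < l 0 / 2"
    using l \<open>l 0 > 0\<close> \<open>t \<ge> 0\<close> unfolding continuous_on_iff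
    by (metis atLeastAtMost_iff half_gt_zero order_refl)
  show ?thesis
  proof
    fix s assume s: "s \<in> {0..t}" "s < d"
    have "integral {0..s} (\<lambda>_. l 0 / 2) \<le> integral {0..s} l"
    proof (rule integral_le)
      show "l integrable_on {0..s}"
        using s by (intro integrable_continuous_interval continuous_on_subset[OF l]) auto
      show "l 0 / 2 \<le> l z" if "z \<in> {0..s}" for z
        using d[of z] that s \<open>d > 0\<close> unfolding dist_real_def by (auto simp: abs_if split: if_splits)
    qed auto
    then show "l 0 / 2 * s \<le> integral {0..s} l" using s by (simp add: mult.commute)
  qed (fact \<open>d > 0\<close>)
qed

text \<open>A \<open>LEAST\<close> over reals needs an attained minimum, and the primitive has the
  trivial zero 0 that could be a limit of others. Positivity on an initial interval confines the
  remaining zeros to the compact set \<open>Z\<close>, whose minimum is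
  \<open>\<tau>\<close>.\<close>

lemma first_zero_of_integral:
  fixes l :: "real \<Rightarrow> real"
  assumes "T > 0" and l: "continuous_on {0..T} l" and "l 0 > 0" and neg: "integral {0..T} l < 0"
  defines "\<tau> \<equiv> LEAST s. s \<in> {0<..<T} \<and> integral {0..s} l = 0"
  shows "\<tau> < T" and "\<And>s. s \<in> {0<..<\<tau>} \<Longrightarrow> integral {0..s} l > 0"
proof -
  define J where "J s = integral {0..s} l" for s
  have J: "continuous_on {0..T} J"
    unfolding J_def by (rule indefinite_integral_continuous_1[OF integrable_continuous_interval[OF l]])
  obtain r where r: "0 < r" "r \<le> T" and J_pos: "\<And>s. s \<in> {0<..r} \<Longrightarrow> J s > 0"
  proof -
    obtain d where "d > 0" and d: "\<And>s. \<lbrakk>s \<in> {0..T}; s < d\<rbrakk> \<Longrightarrow> l 0 / 2 * s \<le> J s"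
      unfolding J_def using integral_initial_lower_bound[OF _ l \<open>l 0 > 0\<close>] \<open>T > 0\<close> by auto
    show ?thesis
    proof
      show "0 < min T (d / 2)" "min T (d / 2) \<le> T" using \<open>d > 0\<close> \<open>T > 0\<close> by auto
      fix s assume s: "s \<in> {0<..min T (d / 2)}"
      have "0 < l 0 / 2 * s" using s \<open>l 0 > 0\<close> by simp
      also have "\<dots> \<le> J s" using s \<open>d > 0\<close> by (intro d) auto
      finally show "J s > 0" .
    qed
  qed
  \<comment> \<open>Intermediate value theorem started at \<open>r\<close>, where \<open>J\<close>
    is already positive. It serves both for the existence of a zero and for positivity before the
    first one.\<close>
  have root: "\<exists>z\<in>{r..s}. J z = 0" if "r \<le> s" "s \<le> T" "J s \<le> 0" for s
  proof -
    have "continuous_on {r..s} J" using that r by (intro continuous_on_subset[OF J]) auto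
    then show ?thesis
      using IVT2'[of J s 0 r] that r J_pos[of r] by auto
  qed
  define Z where "Z = {s \<in> {r..T}. J s = 0}"
  \<comment> \<open>The closed interval adds only the end point \<open>T\<close>, where
    \<open>J < 0\<close>; what it drops lies below \<open>r\<close>, where
    \<open>J > 0\<close>.\<close>
  have Z_iff: "s \<in> {0<..<T} \<and> J s = 0 \<longleftrightarrow> s \<in> Z" for s
    using J_pos[of s] r neg by (cases "s = T"; cases "s \<le> r") (auto simp: Z_def J_def)
  have "Z \<noteq> {}" using root[of T] neg r by (auto simp: Z_def J_def)
  moreover have "compact Z"
  proof -
    have "closed Z" unfolding Z_def
      using r by (intro continuous_closed_preimage_constant continuous_on_subset[OF J]) auto
    moreover have "bounded Z" by (rule bounded_subset[of "{r..T}"]) (auto simp: Z_def)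
    ultimately show ?thesis by (simp add: compact_eq_bounded_closed)
  qed
  ultimately obtain z where z: "z \<in> Z" "\<And>y. y \<in> Z \<Longrightarrow> z \<le> y"
    using compact_attains_inf[of Z] by metis
  have "\<tau> = z"
    unfolding \<tau>_def J_def[symmetric] Z_iff by (rule Least_equality) (use z in auto)
  then show "\<tau> < T" using z Z_iff by auto
  show "integral {0..s} l > 0" if s: "s \<in> {0<..<\<tau>}" for s
  proof (rule ccontr)
    assume "\<not> integral {0..s} l > 0"
    then have "J s \<le> 0" by (simp add: J_def)
    then have "r \<le> s" using J_pos[of s] s by force
    then obtain y where "y \<in> {r..s}" "J y = 0"
      using root \<open>J s \<le> 0\<close> s \<open>\<tau> < T\<close> by force
    then have "y \<in> Z" using s \<open>\<tau> < T\<close> by (auto simp: Z_def)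
    then show False using z(2) \<open>y \<in> {r..s}\<close> s \<open>\<tau> = z\<close> by force
  qed
qed

text \<open>Since the primitive vanishes at 0, the bound has to be proportional to \<open>s\<close>:
  near 0 the slope comes from \<open>l 0 > 0\<close>, further on from the positive minimum on a
  compact interval. \<open>\<eta> * s\<close> is the integral of the constant \<open>\<eta>\<close>,
  so the primitive of \<open>l - \<eta>\<close> stays nonnegative.\<close>

lemma integral_linear_lower_bound:
  fixes l :: "real \<Rightarrow> real"
  assumes "t \<ge> 0" and l: "continuous_on {0..t} l" and "l 0 > 0"
    and pos: "\<And>s. s \<in> {0<..t} \<Longrightarrow> integral {0..s} l > 0"
  obtains \<eta> where "\<eta> > 0" "\<And>s. s \<in> {0..t} \<Longrightarrow> \<eta> * s \<le> integral {0..s} l"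
proof -
  define J where "J s = integral {0..s} l" for s
  have J: "continuous_on {0..t} J"
    unfolding J_def by (rule indefinite_integral_continuous_1[OF integrable_continuous_interval[OF l]])
  obtain d where "d > 0" and small: "\<And>s. \<lbrakk>s \<in> {0..t}; s < d\<rbrakk> \<Longrightarrow> l 0 / 2 * s \<le> J s"
    unfolding J_def using integral_initial_lower_bound[OF assms(1-3)] by auto
  show ?thesis
  proof (cases "d \<le> t")
    case False
    then show ?thesis using that[of "l 0 / 2"] small \<open>l 0 > 0\<close> by (auto simp: J_def)
  next
    case True
    have "continuous_on {d..t} J"
      using \<open>d > 0\<close> by (intro continuous_on_subset[OF J]) auto
    then obtain y where y: "y \<in> {d..t}" "\<And>s. s \<in> {d..t} \<Longrightarrow> J y \<le> J s"
      using continuous_attains_inf[of "{d..t}" J] True by auto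
    have "J y > 0" unfolding J_def by (rule pos) (use y \<open>d > 0\<close> in auto)
    define \<eta> where "\<eta> = min (l 0 / 2) (J y / t)"
    have \<eta>_le: "\<eta> \<le> l 0 / 2" "\<eta> \<le> J y / t"
      unfolding \<eta>_def by (rule min.cobounded1, rule min.cobounded2)
    have "t > 0" using True \<open>d > 0\<close> by simp
    show ?thesis
    proof (rule that)
      show "\<eta> > 0" using \<open>J y > 0\<close> \<open>l 0 > 0\<close> \<open>t > 0\<close> by (simp add: \<eta>_def)
      fix s assume s: "s \<in> {0..t}"
      show "\<eta> * s \<le> integral {0..s} l"
      proof (cases "s < d")
        case True
        have "\<eta> * s \<le> l 0 / 2 * s" using s \<eta>_le by (intro mult_right_mono) auto
        then show ?thesis using small[OF s True] by (simp add: J_def)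
      next
        case False
        have "\<eta> * s \<le> J y / t * t"
          using s \<open>J y > 0\<close> \<open>t > 0\<close> using \<eta>_le by (intro mult_mono) auto
        also have "\<dots> = J y" using \<open>t > 0\<close> by simp
        also have "\<dots> \<le> J s" using y(2)[of s] s False by simp
        finally show ?thesis by (simp add: J_def)
      qed
    qed
  qed
qed

text \<open>First exit argument: up to and including the first time at which the norm reaches
  \<open>\<delta>\<close>, the closed-ball condition of \<open>step\<close> holds, and
  \<open>step\<close> then returns the norm to its initial size, below
  \<open>\<delta>\<close>.\<close>

lemma norm_less_by_continuation:
  fixes u :: "real \<Rightarrow> 'a::real_normed_vector"
  assumes u: "continuous_on {0..t} u" and init: "norm (u 0) < \<delta>"
    and step: "\<And>b. \<lbrakk>b \<in> {0..t}; \<forall>s\<in>{0..b}. norm (u s) \<le> \<delta>\<rbrakk> \<Longrightarrow> norm (u b) \<le> norm (u 0)"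
    and s: "s \<in> {0..t}"
  shows "norm (u s) < \<delta>"
proof (rule ccontr)
  assume "\<not> norm (u s) < \<delta>"
  define S where "S = {r \<in> {0..t}. norm (u r) \<in> {\<delta>..}}"
  have cn: "continuous_on {0..t} (\<lambda>r. norm (u r))" by (intro continuous_intros u)
  then have "closed ({0..t} \<inter> (\<lambda>r. norm (u r)) -` {\<delta>..})"
    by (rule continuous_closed_preimage) auto
  then have "closed S" by (simp add: S_def vimage_def Int_def)
  moreover have "bounded S" by (rule bounded_subset[of "{0..t}"]) (auto simp: S_def)
  ultimately have "compact S" by (simp add: compact_eq_bounded_closed)
  moreover have "s \<in> S" using s \<open>\<not> norm (u s) < \<delta>\<close> by (simp add: S_def)
  ultimately obtain b where b: "b \<in> S" "\<And>r. r \<in> S \<Longrightarrow> b \<le> r"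
    using compact_attains_inf[of S] by (metis empty_iff)
  have bt: "b \<in> {0..t}" "\<delta> \<le> norm (u b)" using b by (auto simp: S_def)
  have "continuous_on {0..b} (\<lambda>r. norm (u r))"
    using bt by (intro continuous_on_subset[OF cn]) auto
  then obtain r where r: "0 \<le> r" "r \<le> b" "norm (u r) = \<delta>"
    using IVT'[of "\<lambda>r. norm (u r)" 0 \<delta> b] bt init by auto
  \<comment> \<open>Minimality of \<open>b\<close> identifies it with the point from the
    intermediate value theorem, so the norm at \<open>b\<close> is exactly \<open>\<delta>\<close>
    and the closed-ball condition includes \<open>b\<close> itself.\<close>
  then have "r = b" using b(2)[of r] bt by (auto simp: S_def)
  have "\<forall>r\<in>{0..b}. norm (u r) \<le> \<delta>"
  proof
    fix q assume q: "q \<in> {0..b}"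
    show "norm (u q) \<le> \<delta>"
    proof (cases "q = b")
      case False
      then have "q \<notin> S" using b(2)[of q] q by force
      then show ?thesis using q bt by (auto simp: S_def)
    qed (use r \<open>r = b\<close> in simp)
  qed
  then have "norm (u b) \<le> norm (u 0)" by (rule step[OF bt(1)])
  then show False using init bt by simp
qed

text \<open>\<open>c\<close> stands for \<open>lambda1\<close> minus a constant. The Gronwall
  exponent is \<open>- 2 / e\<close> times the integral of \<open>c\<close>, so its sign is the same
  for every \<open>e > 0\<close>; continuation then removes the assumption that the solution stays
  in the ball.\<close>

lemma gradient_flow_barrier:
  fixes F :: "real \<Rightarrow> 'a::euclidean_space \<Rightarrow> real"
  assumes "e > 0" and t: "0 \<le> t" "t \<le> T"
    and sol: "gradient_flow_solution T F e u"
    and cont: "continuous_on ({0..T} \<times> UNIV) (\<lambda>(s, x). gradient (F s) x)"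
    and c: "continuous_on {0..t} c"
    and lower: "\<And>s x. \<lbrakk>s \<in> {0..t}; norm x \<le> \<delta>\<rbrakk> \<Longrightarrow> c s * (x \<bullet> x) \<le> gradient (F s) x \<bullet> x"
    and int_nonneg: "\<And>s. s \<in> {0..t} \<Longrightarrow> integral {0..s} c \<ge> 0"
    and init: "norm (u 0) < \<delta>" and s: "s \<in> {0..t}"
  shows "norm (u s) \<le> norm (u 0)"
proof -
  have decay: "norm (u b) \<le> norm (u 0)" if b: "b \<in> {0..t}" and small: "\<forall>r\<in>{0..b}. norm (u r) \<le> \<delta>" for b
  proof -
    have sub: "{0..b} \<subseteq> {0..t}" "{0..b} \<subseteq> {0..T}" using b t by auto
    have "u b \<bullet> u b \<le> (u 0 \<bullet> u 0) * exp (- integral {0..b} (\<lambda>r. 2 / e * c r))"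
    proof (rule exponential_decay)
      show "continuous_on {0..b} (\<lambda>r. 2 / e * c r)"
        by (intro continuous_intros continuous_on_subset[OF c sub(1)])
      fix r assume r: "r \<in> {0..b}"
      have du: "(u has_vector_derivative - (1 / e) *\<^sub>R gradient (F r) (u r)) (at r within {0..b})"
        by (rule has_vector_derivative_within_subset
            [OF gradient_flow_solution_has_vector_derivative[OF sol \<open>e > 0\<close> cont] sub(2)]) (use r sub in auto)
      show "((\<lambda>r. u r \<bullet> u r) has_real_derivative - (2 / e) * (gradient (F r) (u r) \<bullet> u r)) (at r within {0..b})"
        using has_derivative_inner[OF du[unfolded has_vector_derivative_def] du[unfolded has_vector_derivative_def]]
        unfolding has_field_derivative_def
        by (rule has_derivative_eq_rhs) (auto simp: fun_eq_iff inner_commute)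
      have "c r * (u r \<bullet> u r) \<le> gradient (F r) (u r) \<bullet> u r"
        using r small sub by (intro lower) auto
      then show "- (2 / e) * (gradient (F r) (u r) \<bullet> u r) \<le> - (2 / e * c r) * (u r \<bullet> u r)"
        using \<open>e > 0\<close> by (simp add: divide_right_mono)
    qed (use b in auto)
    also have "\<dots> \<le> (u 0 \<bullet> u 0) * 1"
      using int_nonneg[OF b] \<open>e > 0\<close> by (intro mult_left_mono) auto
    finally show ?thesis by (simp add: norm_le)
  qed
  have "continuous_on {0..t} u"
    using sol t unfolding gradient_flow_solution_def
    by (meson absolutely_continuous_fun_on_imp_continuous_on continuous_on_subset atLeastatMost_subset_iff order_refl)
  then have "norm (u r) < \<delta>" if "r \<in> {0..t}" for r
    by (rule norm_less_by_continuation) (use init decay that in auto)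
  then show ?thesis
    using decay[OF s] s by force
qed

theorem proposition3p1:
  fixes F :: "real \<Rightarrow> 'a::euclidean_space \<Rightarrow> real"
    and T :: real
    and \<epsilon> :: "nat \<Rightarrow> real"
    and u :: "nat \<Rightarrow> real \<Rightarrow> 'a"
    and t :: real
  assumes T_pos: "T > 0"
    and F0: "C2_on (\<lambda>(s, x). F s x) ({0..T} \<times> UNIV)"
    and F1: "\<forall>\<rho>>0. bounded {x. (SUP s\<in>{0..T}. \<bar>F s x\<bar>) \<le> \<rho>}"
    and F2: "\<exists>C1>0. \<exists>C2>0. \<forall>s\<in>{0..T}. \<forall>x. \<bar>time_derivative T F s x\<bar> \<le> C1 * F s x + C2"
    and F3: "\<forall>s\<in>{0..T}. discrete (critical_points F s)"
    and zero_critical: "\<forall>s\<in>{0..T}. gradient (F s) 0 = 0"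
    and lambda_0: "lambda1 F 0 > 0"
    and lambda_int: "integral {0..T} (lambda1 F) < 0"
    and eps_pos: "\<forall>k. \<epsilon> k > 0"
    and eps_lim: "\<epsilon> \<longlonglongrightarrow> 0"
    and sol: "\<forall>k. gradient_flow_solution T F (\<epsilon> k) (u k)"
    and init: "(\<lambda>k. u k 0) \<longlonglongrightarrow> 0"
    and t_range: "t \<in> {0..<t_star T F}"
  shows "uniform_limit {0..t} u (\<lambda>s. 0) sequentially"
proof -
  obtain H :: "real \<times> 'a \<Rightarrow> 'a \<Rightarrow>\<^sub>L 'a" where
    G_cont: "continuous_on ({0..T} \<times> UNIV) (\<lambda>(s, x). gradient (F s) x)" and
    H_cont: "continuous_on ({0..T} \<times> UNIV) H" and
    G_der: "\<And>s x. s \<in> {0..T} \<Longrightarrow> (gradient (F s) has_derivative H (s, x)) (at x)" and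
    H_sym: "\<And>s x h k. s \<in> {0..T} \<Longrightarrow> H (s, x) h \<bullet> k = h \<bullet> H (s, x) k"
    using C2_on_gradient_hessian[OF F0] by blast
  \<comment> \<open>\<open>hessian\<close> selects some derivative; uniqueness of the derivative
    identifies it with \<open>H\<close>.\<close>
  have lam: "lambda1 F s = min_eigenvalue (H (s, 0))" if "s \<in> {0..T}" for s
    unfolding lambda1_def hessian_def using frechet_derivative_at[OF G_der[OF that]] by metis
  have "continuous_on {0..T} (\<lambda>s. H (s, 0))"
    by (rule continuous_on_compose2[OF H_cont]) (auto intro!: continuous_intros)
  then have "continuous_on {0..T} (\<lambda>s. min_eigenvalue (H (s, 0)))"
    by (rule continuous_on_min_eigenvalue) (use H_sym in auto)
  then have lam_cont: "continuous_on {0..T} (lambda1 F)"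
    by (rule continuous_on_eq) (simp add: lam)
  have "t_star T F < T" and pos: "\<And>s. s \<in> {0<..<t_star T F} \<Longrightarrow> integral {0..s} (lambda1 F) > 0"
    unfolding t_star_def by (rule first_zero_of_integral[OF T_pos lam_cont lambda_0 lambda_int]; assumption)+
  then have t: "0 \<le> t" "t \<le> T" using t_range by auto
  have lam_cont_t: "continuous_on {0..t} (lambda1 F)"
    by (rule continuous_on_subset[OF lam_cont]) (use t in auto)
  obtain \<eta> where "\<eta> > 0" and \<eta>: "\<And>s. s \<in> {0..t} \<Longrightarrow> \<eta> * s \<le> integral {0..s} (lambda1 F)"
    using integral_linear_lower_bound[OF t(1) lam_cont_t lambda_0] pos t_range
    by (metis atLeastLessThan_iff greaterThanAtMost_iff greaterThanLessThan_iff le_less_trans)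
  obtain \<delta> where "\<delta> > 0" and \<delta>: "\<And>s x. \<lbrakk>s \<in> {0..T}; norm x \<le> \<delta>\<rbrakk>
      \<Longrightarrow> H (s, 0) x \<bullet> x - \<eta> * (x \<bullet> x) \<le> gradient (F s) x \<bullet> x"
    using inner_lower_bound_near_zero[OF compact_Icc H_cont G_der _ \<open>\<eta> > 0\<close>] zero_critical by metis
  have bound: "norm (u k s) \<le> norm (u k 0)" if "norm (u k 0) < \<delta>" "s \<in> {0..t}" for k s
  proof (rule gradient_flow_barrier[OF _ t _ G_cont, where c="\<lambda>s. lambda1 F s - \<eta>" and e="\<epsilon> k"])
    show "(lambda1 F s - \<eta>) * (x \<bullet> x) \<le> gradient (F s) x \<bullet> x" if "s \<in> {0..t}" "norm x \<le> \<delta>" for s x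
    proof -
      have s: "s \<in> {0..T}" using that t by auto
      have "lambda1 F s * (x \<bullet> x) \<le> H (s, 0) x \<bullet> x"
        unfolding lam[OF s]
        using min_eigenvalue_rayleigh[of "H (s, 0)"] H_sym[OF s] by (metis bounded_linear.linear blinfun.bounded_linear_right)
      then show ?thesis using \<delta>[OF s that(2)] by (simp add: algebra_simps)
    qed
    show "integral {0..s} (\<lambda>s. lambda1 F s - \<eta>) \<ge> 0" if s: "s \<in> {0..t}" for s
    proof -
      have "lambda1 F integrable_on {0..s}"
        using s by (intro integrable_continuous_interval continuous_on_subset[OF lam_cont_t]) auto
      then show ?thesis
        using \<eta>[OF s] s
        by (subst integral_diff) (auto simp: integrable_const_ivl mult.commute)
    qed
  qed (use that eps_pos sol lam_cont_t in \<open>auto intro!: continuous_intros\<close>)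
  show ?thesis
  proof (rule uniform_limitI)
    fix e :: real assume "e > 0"
    \<comment> \<open>Starting below \<open>\<delta>\<close> makes \<open>bound\<close> applicable;
      starting below \<open>e\<close> makes it sufficient.\<close>
    then have "\<forall>\<^sub>F k in sequentially. norm (u k 0) < min e \<delta>"
      using tendstoD[OF init, of "min e \<delta>"] \<open>\<delta> > 0\<close> by (simp add: dist_norm)
    then show "\<forall>\<^sub>F k in sequentially. \<forall>s\<in>{0..t}. dist (u k s) 0 < e"
      by eventually_elim (use bound in \<open>fastforce simp: dist_norm intro: le_less_trans\<close>)
  qed
qed

end
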